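(* Let $A(t)$, $t\in\mathbb{Z}$, be an $n\times n$ matrix function and suppose that the homogeneous system $$x(t+1)=A(t)x(t),\qquad x(t_0)=x_0,\qquad t\in\mathbb{Z},$$ admits an exponential dichotomy. Then the projection $P$ of the exponential dichotomy is unique; that is, if $P$ and $\tilde P$ are projections such that the system admits an exponential dichotomy with projection $P$ (and some positive constants) and also with projection $\tilde P$ (and some positive constants), then $P=\tilde P$.
   Context: $\mathcal{X}$ is the space $\mathbb{R}^n$ or $\mathbb{C}^n$ with a norm $\|\cdot\|_{\mathcal{X}}$, and $\mathcal{B}(\mathcal{X})$ is the space of (bounded) linear operators on $\mathcal{X}$ with the operator norm $\|L\|_{\mathcal{B}(\mathcal{X})}=\sup\{\|Lx\|_{\mathcal{X}}:\|x\|_{\mathcal{X}}\le 1\}$. Fix $t_0\in\mathbb{Z}$. $X(t)$, $t\in\mathbb{Z}$, denotes the principal fundamental matrix solution of $x(t+1)=A(t)x(t)$, i.e. $X(t+1)=A(t)X(t)$ for all $t\in\mathbb{Z}$ and $X(t_0)=I$; the matrices $A(t)$ are invertible, so that $X(t)$ is defined on $\mathbb{Z}$ and $X^{-1}(s)$ denotes the inverse of $X(s)$. Exponential dichotomy: the system $x(t+1)=A(t)x(t)$, $x(t_0)=x_0$, admits an exponential dichotomy if there exist a projection $P$ (a matrix with $P^2=P$) and positive constants $\alpha_1,\alpha_2,\beta_1,\beta_2$ such that, for $t,s\in\mathbb{Z}$, $$\|X(t)PX^{-1}(s)\|_{\mathcal{B}(\mathcal{X})}\le\beta_1(1+\alpha_1)^{s-t},\quad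 t\ge s,$$ $$\|X(t)(I-P)X^{-1}(s)\|_{\mathcal{B}(\mathcal{X})}\le\beta_2(1+\alpha_2)^{t-s},\quad s\ge t.$$ *)

theory Defs
  imports "HOL-Analysis.Analysis"
begin

(* The scalar field is a type variable of sort {real_normed_field, euclidean_space}: a
   finite-dimensional normed field over the reals, i.e. (up to isometric isomorphism)
   exactly real or complex. The norm on the space of n-vectors is an arbitrary function N
   satisfying the norm axioms; it need not be the library's Euclidean norm on vectors. *)

definition is_norm :: "(('k::{real_normed_field,euclidean_space})^'n \<Rightarrow> real) \<Rightarrow> bool" where
  "is_norm N \<longleftrightarrow>
     (\<forall>x. 0 \<le> N x) \<and> (\<forall>x. N x = 0 \<longleftrightarrow> x = 0) \<and>
     (\<forall>c x. N (c *s x) = norm c * N x) \<and>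
     (\<forall>x y. N (x + y) \<le> N x + N y)"

(* In finite dimension every norm is equivalent to the Euclidean one, so this supremum is over
   a nonempty bounded set of reals whenever N is a norm. *)
definition op_norm ::
    "(('k::{real_normed_field,euclidean_space})^'n \<Rightarrow> real) \<Rightarrow> 'k^'n^'n \<Rightarrow> real" where
  "op_norm N L = (SUP x\<in>{x. N x \<le> 1}. N (L *v x))"

definition is_principal_fundamental_matrix ::
    "(int \<Rightarrow> ('k::{real_normed_field,euclidean_space})^'n^'n) \<Rightarrow> int \<Rightarrow> (int \<Rightarrow> 'k^'n^'n) \<Rightarrow> bool" where
  "is_principal_fundamental_matrix A t0 X \<longleftrightarrow>
     X t0 = mat 1 \<and> (\<forall>t. X (t + 1) = A t ** X t)"

definition fundamental_matrix ::
    "(int \<Rightarrow> ('k::{real_normed_field,euclidean_space})^'n^'n) \<Rightarrow> int \<Rightarrow> int \<Rightarrow> 'k^'n^'n" where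
  "fundamental_matrix A t0 = (THE X. is_principal_fundamental_matrix A t0 X)"

lemma ex1_principal_fundamental_matrix:
  fixes A :: "int \<Rightarrow> ('k::{real_normed_field,euclidean_space})^'n^'n"
  assumes inv: "\<And>t. invertible (A t)"
  shows "\<exists>!X. is_principal_fundamental_matrix A t0 X"
proof -
  have AB: "A t ** matrix_inv (A t) = mat 1" and BA: "matrix_inv (A t) ** A t = mat 1" for t
    using someI_ex[OF inv[unfolded invertible_def]] by (auto simp: matrix_inv_def)
  define F where "F = rec_nat (mat 1) (\<lambda>k M. A (t0 + int k) ** M)"
  define G where "G = rec_nat (mat 1) (\<lambda>k M. matrix_inv (A (t0 - int k - 1)) ** M)"
  define X where "X t = (if t \<ge> t0 then F (nat (t - t0)) else G (nat (t0 - t)))" for t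
  have "X (t + 1) = A t ** X t" for t
  proof (cases "t \<ge> t0")
    case True
    then have "nat (t + 1 - t0) = Suc (nat (t - t0))" by simp
    with True show ?thesis by (simp add: X_def F_def)
  next
    case False
    then have "nat (t0 - t) = Suc (nat (t0 - (t + 1)))" by simp
    moreover from False have "t0 - int (nat (t0 - (t + 1))) - 1 = t" by simp
    ultimately have "G (nat (t0 - t)) = matrix_inv (A t) ** G (nat (t0 - (t + 1)))"
      by (simp add: G_def)
    then have "A t ** X t = G (nat (t0 - (t + 1)))"
      using False AB by (simp add: X_def matrix_mul_assoc)
    also have "\<dots> = X (t + 1)"
      using False by (cases "t + 1 = t0") (auto simp: X_def F_def G_def)
    finally show ?thesis ..
  qed
  then have ex: "is_principal_fundamental_matrix A t0 X"
    by (simp add: is_principal_fundamental_matrix_def X_def F_def)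
  have "Y t = X t" if Y: "is_principal_fundamental_matrix A t0 Y" for Y t
  proof (induction t rule: int_induct[where k = t0])
    case base
    show ?case using ex Y by (simp add: is_principal_fundamental_matrix_def)
  next
    case (step1 i)
    then show ?case using ex Y by (simp add: is_principal_fundamental_matrix_def)
  next
    case (step2 i)
    have bwd: "Z (i - 1) = matrix_inv (A (i - 1)) ** Z i"
      if "is_principal_fundamental_matrix A t0 Z" for Z
    proof -
      have "Z i = A (i - 1) ** Z (i - 1)"
        using that unfolding is_principal_fundamental_matrix_def by (metis diff_add_cancel)
      then show ?thesis by (simp add: matrix_mul_assoc BA)
    qed
    show ?case using step2 bwd[OF ex] bwd[OF Y] by simp
  qed
  then show ?thesis using ex by (metis ext)
qed

lemma fundamental_matrix:
  assumes "\<And>t. invertible (A t)"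
  shows "fundamental_matrix A t0 t0 = mat 1"
    and "fundamental_matrix A t0 (t + 1) = A t ** fundamental_matrix A t0 t"
  using theI'[OF ex1_principal_fundamental_matrix[OF assms]]
  by (simp_all add: fundamental_matrix_def is_principal_fundamental_matrix_def)

definition exponential_dichotomy_with ::
    "(('k::{real_normed_field,euclidean_space})^'n \<Rightarrow> real) \<Rightarrow> (int \<Rightarrow> 'k^'n^'n) \<Rightarrow> int \<Rightarrow>
     'k^'n^'n \<Rightarrow> bool" where
  "exponential_dichotomy_with N A t0 P \<longleftrightarrow>
     P ** P = P \<and>
     (\<exists>\<alpha>\<^sub>1 \<alpha>\<^sub>2 \<beta>\<^sub>1 \<beta>\<^sub>2 :: real. \<alpha>\<^sub>1 > 0 \<and> \<alpha>\<^sub>2 > 0 \<and> \<beta>\<^sub>1 > 0 \<and> \<beta>\<^sub>2 > 0 \<and>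
       (let X = fundamental_matrix A t0 in
         (\<forall>t s. t \<ge> s \<longrightarrow>
           op_norm N (X t ** P ** matrix_inv (X s)) \<le> \<beta>\<^sub>1 * (1 + \<alpha>\<^sub>1) powi (s - t)) \<and>
         (\<forall>t s. s \<ge> t \<longrightarrow>
           op_norm N (X t ** (mat 1 - P) ** matrix_inv (X s)) \<le> \<beta>\<^sub>2 * (1 + \<alpha>\<^sub>2) powi (t - s))))"

end

theory Submission
  imports Defs
begin

text \<open>
  For two dichotomy projections \<open>P\<close> and \<open>Q\<close>, the factorisation
  \<open>(I - Q) P = (X(t\<^sub>0) (I - Q) X\<^sup>-\<^sup>1(s)) (X(s) P X\<^sup>-\<^sup>1(t\<^sub>0))\<close> bounds \<open>(I - Q) P\<close> by a product of two
  exponentials decaying as \<open>s\<close> tends to infinity, so \<open>(I - Q) P = 0\<close>. Letting \<open>s\<close> tend to minus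
  infinity in the analogous factorisation of \<open>Q (I - P)\<close> gives \<open>Q (I - P) = 0\<close>. Hence
  \<open>P = Q P = Q\<close>.
\<close>

section \<open>Equivalence of an arbitrary norm with the Euclidean one; the induced operator
  norm\<close>

context
  fixes N :: "('k::{real_normed_field,euclidean_space})^'n \<Rightarrow> real"
  assumes N: "is_norm N"
begin

lemma is_norm_nonneg: "0 \<le> N x"
  and is_norm_eq_0_iff: "N x = 0 \<longleftrightarrow> x = 0"
  and is_norm_scale: "N (c *s x) = norm c * N x"
  and is_norm_triangle: "N (x + y) \<le> N x + N y"
  using N by (auto simp: is_norm_def)

lemma is_norm_scaleR: "N (r *\<^sub>R x) = \<bar>r\<bar> * N x"
proof -
  \<comment> \<open>Homogeneity of \<open>N\<close> is given for scalars of \<open>'k\<close> only,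
    so the real scalar is first embedded in the field.\<close>
  have "r *\<^sub>R x = (of_real r :: 'k) *s x"
    by (simp add: vec_eq_iff scaleR_conv_of_real[where 'a = 'k])
  then show ?thesis by (simp add: is_norm_scale)
qed

lemma is_norm_sum_le: "finite S \<Longrightarrow> N (sum f S) \<le> (\<Sum>i\<in>S. N (f i))"
proof (induction S rule: finite_induct)
  case empty
  then show ?case by (simp add: is_norm_eq_0_iff[THEN iffD2])
next
  case (insert i S)
  then show ?case using is_norm_triangle[of "f i" "sum f S"] by simp
qed

text \<open>Expand in the standard basis: each coordinate is at most the Euclidean norm, so the sum
  of the \<open>N\<close>-values of the basis vectors serves as constant.\<close>

lemma is_norm_le_norm: "\<exists>C. \<forall>x. N x \<le> C * norm x"
proof (intro exI allI)
  fix x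
  have "N x = N (\<Sum>i\<in>UNIV. (x $ i) *s axis i 1)"
    by (simp only: basis_expansion)
  also have "\<dots> \<le> (\<Sum>i\<in>UNIV. norm (x $ i) * N (axis i 1))"
    using is_norm_sum_le[of UNIV "\<lambda>i. (x $ i) *s axis i 1"] by (simp add: is_norm_scale)
  also have "\<dots> \<le> (\<Sum>i\<in>UNIV. norm x * N (axis i 1))"
    by (intro sum_mono mult_right_mono Finite_Cartesian_Product.norm_nth_le is_norm_nonneg)
  finally show "N x \<le> (\<Sum>i\<in>UNIV. N (axis i 1)) * norm x"
    by (simp add: sum_distrib_left mult.commute)
qed

lemma is_norm_continuous_on: "continuous_on S N"
proof -
  obtain C where C: "N x \<le> C * norm x" for x
    using is_norm_le_norm by blast
  \<comment> \<open>Reverse triangle inequality in both directions; the absolute value makes the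
    Lipschitz constant nonnegative whatever the sign of \<open>C\<close>.\<close>
  have "\<bar>N x - N y\<bar> \<le> \<bar>C\<bar> * norm (x - y)" for x y
  proof -
    have "N x \<le> N (x - y) + N y" "N y \<le> N (y - x) + N x"
      using is_norm_triangle[of "x - y" y] is_norm_triangle[of "y - x" x] by simp_all
    moreover have "N (x - y) \<le> \<bar>C\<bar> * norm (x - y)" "N (y - x) \<le> \<bar>C\<bar> * norm (x - y)"
      using C[of "x - y"] C[of "y - x"] mult_right_mono[OF abs_ge_self, of "norm (x - y)" C]
      by (simp_all add: norm_minus_commute)
    ultimately show ?thesis by linarith
  qed
  then have "\<bar>C\<bar>-lipschitz_on S N"
    by (intro lipschitz_onI) (simp_all add: dist_norm)
  then show ?thesis by (rule lipschitz_on_continuous_on)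
qed

text \<open>By continuity \<open>N\<close> attains its minimum on the compact Euclidean unit sphere.
  Definiteness makes this minimum positive, and scaling carries its inverse over to all vectors as
  the constant.\<close>

lemma norm_le_is_norm: "\<exists>C. \<forall>x. norm x \<le> C * N x"
proof -
  have "compact (sphere (0::'k^'n) 1)" "sphere (0::'k^'n) 1 \<noteq> {}"
    by simp_all
  from continuous_attains_inf[OF this is_norm_continuous_on]
  obtain u where u: "norm u = 1" and min: "\<And>y. norm y = 1 \<Longrightarrow> N u \<le> N y"
    by auto
  have pos: "N u > 0"
    using u is_norm_nonneg[of u] is_norm_eq_0_iff[of u] by fastforce
  have "norm x \<le> inverse (N u) * N x" for x
  proof (cases "x = 0")
    case False
    then have "N u \<le> N (inverse (norm x) *\<^sub>R x)"
      by (intro min) simp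
    then show ?thesis
      using pos False by (simp add: is_norm_scaleR field_simps)
  qed (simp add: is_norm_nonneg pos less_imp_le)
  then show ?thesis by blast
qed

text \<open>Makes the supremum in \<open>op_norm\<close> a genuine least upper bound. The
  \<open>N\<close>-unit ball is bounded in the Euclidean norm, a linear map keeps it so, and the
  converse comparison leads back to \<open>N\<close>.\<close>

lemma bdd_above_op_norm: "bdd_above ((\<lambda>x. N (L *v x)) ` {x. N x \<le> 1})"
proof -
  obtain C where C: "N x \<le> C * norm x" for x
    using is_norm_le_norm by blast
  obtain D where D: "norm x \<le> D * N x" for x
    using norm_le_is_norm by blast
  \<comment> \<open>\<open>L\<close> acts linearly over \<open>'k\<close>, but boundedness is drawn
    from linearity over the reals; the scalar law is checked coordinatewise.\<close>
  have "linear ((*v) L)"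
    by (intro linearI)
      (simp_all add: matrix_vector_right_distrib, simp add: matrix_vector_mult_def vec_eq_iff scaleR_sum_right)
  then obtain B where B: "norm (L *v x) \<le> B * norm x" for x
    using linear_bounded by blast
  have "N (L *v x) \<le> \<bar>C\<bar> * (\<bar>B\<bar> * \<bar>D\<bar>)" if "N x \<le> 1" for x
  proof -
    have "norm x \<le> \<bar>D\<bar> * 1"
      using D[of x] that is_norm_nonneg[of x]
      by (meson abs_ge_self abs_ge_zero mult_mono order_trans)
    then have "norm (L *v x) \<le> \<bar>B\<bar> * \<bar>D\<bar>"
      using B[of x] by (smt (verit) mult_mono norm_ge_zero)
    then show ?thesis
      using C[of "L *v x"] by (smt (verit) mult_mono norm_ge_zero)
  qed
  then show ?thesis by (intro bdd_aboveI2) simp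
qed

lemma op_norm_nonneg: "0 \<le> op_norm N L"
proof -
  have "N (L *v 0) \<le> op_norm N L"
    unfolding op_norm_def
    by (intro cSUP_upper bdd_above_op_norm) (simp add: is_norm_eq_0_iff[THEN iffD2])
  then show ?thesis
    using is_norm_nonneg[of "L *v 0"] by linarith
qed

lemma is_norm_matrix_vector_le: "N (L *v x) \<le> op_norm N L * N x"
proof (cases "x = 0")
  case True
  then show ?thesis by (simp add: is_norm_eq_0_iff[THEN iffD2])
next
  case False
  then have pos: "N x > 0"
    using is_norm_nonneg[of x] is_norm_eq_0_iff[of x] by linarith
  \<comment> \<open>This factor moves \<open>x\<close> onto the \<open>N\<close>-unit sphere, where
    the supremum applies.\<close>
  define c :: 'k where "c = of_real (inverse (N x))"
  have c: "norm c = inverse (N x)"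
    using pos by (simp add: c_def norm_inverse)
  have "N (L *v (c *s x)) \<le> op_norm N L"
    unfolding op_norm_def
    using pos by (intro cSUP_upper bdd_above_op_norm) (simp add: is_norm_scale c)
  moreover have "N (L *v (c *s x)) = inverse (N x) * N (L *v x)"
    by (simp add: vector_scalar_commute is_norm_scale c)
  ultimately show ?thesis
    using pos by (simp add: field_simps)
qed

lemma op_norm_mult_le: "op_norm N (L ** M) \<le> op_norm N L * op_norm N M"
proof (subst op_norm_def, rule cSUP_least)
  show "{x. N x \<le> 1} \<noteq> {}"
    using is_norm_eq_0_iff[of 0] by (auto intro!: exI[of _ 0])
  fix x assume "x \<in> {x. N x \<le> 1}"
  then have x: "N x \<le> 1" by simp
  have "N (L *v (M *v x)) \<le> op_norm N L * N (M *v x)"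
    by (rule is_norm_matrix_vector_le)
  also have "\<dots> \<le> op_norm N L * (op_norm N M * N x)"
    by (intro mult_left_mono is_norm_matrix_vector_le op_norm_nonneg)
  also have "\<dots> \<le> op_norm N L * (op_norm N M * 1)"
    by (intro mult_left_mono x op_norm_nonneg)
  finally show "N ((L ** M) *v x) \<le> op_norm N L * op_norm N M"
    by (simp add: matrix_vector_mul_assoc)
qed

lemma op_norm_le_0_imp_eq_0:
  assumes "op_norm N L \<le> 0"
  shows "L = 0"
proof -
  have "L *v x = 0" for x
  proof -
    have "N (L *v x) \<le> 0"
      using is_norm_matrix_vector_le[of L x] mult_right_mono[OF assms is_norm_nonneg[of x]] by simp
    then show ?thesis
      using is_norm_nonneg[of "L *v x"] is_norm_eq_0_iff by (metis order_antisym)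
  qed
  then show ?thesis by (simp add: matrix_eq)
qed

text \<open>The product \<open>M\<close> is the same for every \<open>k\<close> while its factors
  vary, so submultiplicativity bounds one fixed number by a sequence tending to 0.\<close>

lemma eq_0_if_factors_decay:
  assumes "\<And>k::nat. M = L k ** R k"
    and L: "\<And>k. op_norm N (L k) \<le> b * inverse (1 + a) ^ k"
    and R: "\<And>k. op_norm N (R k) \<le> d * inverse (1 + c) ^ k"
    and "a > 0" "c > 0"
  shows "M = 0"
proof (rule op_norm_le_0_imp_eq_0)
  have "op_norm N M \<le> (b * inverse (1 + a) ^ k) * (d * inverse (1 + c) ^ k)" for k
  proof -
    have "op_norm N M \<le> op_norm N (L k) * op_norm N (R k)"
      by (subst assms(1)[of k]) (rule op_norm_mult_le)
    \<comment> \<open>The bound on \<open>L k\<close> is nonnegative because it dominates an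
      operator norm.\<close>
    also have "\<dots> \<le> (b * inverse (1 + a) ^ k) * (d * inverse (1 + c) ^ k)"
      by (intro mult_mono L R op_norm_nonneg order_trans[OF op_norm_nonneg L])
    finally show ?thesis .
  qed
  moreover have "(\<lambda>k. (b * inverse (1 + a) ^ k) * (d * inverse (1 + c) ^ k))
      \<longlonglongrightarrow> (b * 0) * (d * 0)"
    using assms(4,5) by (intro tendsto_intros LIMSEQ_power_zero) (simp_all add: field_simps)
  ultimately show "op_norm N M \<le> 0"
    by (intro LIMSEQ_le_const[where X = "\<lambda>k. (b * inverse (1 + a) ^ k) * (d * inverse (1 + c) ^ k)"])
      auto
qed

end

section \<open>Matrix algebra: distributivity and inverses\<close>

lemma matrix_diff_ldistrib: "A ** (B - C) = A ** B - A ** C"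
  for A :: "'a::ring_1^'n^'m" and B C :: "'a^'p^'n"
  by (simp add: matrix_matrix_mult_def vec_eq_iff right_diff_distrib sum_subtractf)

lemma matrix_diff_rdistrib: "(A - B) ** C = A ** C - B ** C"
  for A B :: "'a::ring_1^'n^'m" and C :: "'a^'p^'n"
  by (simp add: matrix_matrix_mult_def vec_eq_iff left_diff_distrib sum_subtractf)

lemma matrix_inv_mult_self:
  fixes A :: "'a::semiring_1^'n^'m"
  assumes "invertible A"
  shows "matrix_inv A ** A = mat 1"
  using someI_ex[OF assms[unfolded invertible_def]] by (simp add: matrix_inv_def)

text \<open>An equivalence, so that invertibility can be carried along the recursion both forward
  and backward in time.\<close>

lemma matrix_mult_invertible_iff:
  fixes A B :: "'a::semiring_1^'n^'n"
  assumes "invertible A"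
  shows "invertible (A ** B) \<longleftrightarrow> invertible B"
proof
  assume AB: "invertible (A ** B)"
  from assms obtain C where C: "A ** C = mat 1" "C ** A = mat 1"
    by (auto simp: invertible_def)
  then have "invertible C" by (auto simp: invertible_def)
  from invertible_mult[OF this AB] show "invertible B"
    by (simp add: matrix_mul_assoc C)
qed (use assms in \<open>simp add: invertible_mult\<close>)

section \<open>Fundamental matrix and dichotomy estimates\<close>

lemma invertible_fundamental_matrix:
  fixes A :: "int \<Rightarrow> ('k::{real_normed_field,euclidean_space})^'n^'n"
  assumes "\<And>t. invertible (A t)"
  shows "invertible (fundamental_matrix A t0 t)"
proof -
  have step: "invertible (fundamental_matrix A t0 (t + 1)) \<longleftrightarrow> invertible (fundamental_matrix A t0 t)" for t
    by (simp add: fundamental_matrix(2)[OF assms] matrix_mult_invertible_iff assms)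
  show ?thesis
  proof (induction t rule: int_induct[where k = t0])
    case base
    have "invertible (mat 1 :: 'k^'n^'n)"
      unfolding invertible_def by (rule exI[of _ "mat 1"]) simp
    then show ?case by (simp add: fundamental_matrix(1)[OF assms])
  next
    case (step1 i)
    then show ?case by (simp add: step)
  next
    case (step2 i)
    then show ?case using step[of "i - 1"] by simp
  qed
qed

text \<open>Restates the estimates by the time gap \<open>k\<close>: the exponent becomes
  \<open>- int k\<close>, and the integer power turns into the geometric form that
  \<open>eq_0_if_factors_decay\<close> takes.\<close>

lemma exponential_dichotomy_withE:
  assumes "exponential_dichotomy_with N A t0 P"
  obtains \<alpha> \<beta> \<gamma> \<delta> :: real where "\<alpha> > 0" "\<gamma> > 0"
    "\<And>t s k. t = s + int k \<Longrightarrow>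
       op_norm N (fundamental_matrix A t0 t ** P ** matrix_inv (fundamental_matrix A t0 s))
         \<le> \<beta> * inverse (1 + \<alpha>) ^ k"
    "\<And>t s k. s = t + int k \<Longrightarrow>
       op_norm N (fundamental_matrix A t0 t ** (mat 1 - P) ** matrix_inv (fundamental_matrix A t0 s))
         \<le> \<delta> * inverse (1 + \<gamma>) ^ k"
proof -
  have powi: "x powi (- int k) = inverse x ^ k" for x :: real and k
    by (simp add: power_int_minus power_inverse)
  from assms obtain \<alpha> \<gamma> \<beta> \<delta> :: real where pos: "\<alpha> > 0" "\<gamma> > 0"
    and P: "\<And>t s. s \<le> t \<Longrightarrow>
      op_norm N (fundamental_matrix A t0 t ** P ** matrix_inv (fundamental_matrix A t0 s))
        \<le> \<beta> * (1 + \<alpha>) powi (s - t)"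
    and Q: "\<And>t s. t \<le> s \<Longrightarrow>
      op_norm N (fundamental_matrix A t0 t ** (mat 1 - P) ** matrix_inv (fundamental_matrix A t0 s))
        \<le> \<delta> * (1 + \<gamma>) powi (t - s)"
    unfolding exponential_dichotomy_with_def Let_def by blast
  show ?thesis
  proof (rule that[OF pos])
    fix t s k assume "t = s + int k"
    then show "op_norm N (fundamental_matrix A t0 t ** P ** matrix_inv (fundamental_matrix A t0 s))
        \<le> \<beta> * inverse (1 + \<alpha>) ^ k"
      using P[of s t] powi[of "1 + \<alpha>" k] by simp
  next
    fix t s k assume "s = t + int k"
    then show "op_norm N (fundamental_matrix A t0 t ** (mat 1 - P) ** matrix_inv (fundamental_matrix A t0 s))
        \<le> \<delta> * inverse (1 + \<gamma>) ^ k"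
      using Q[of t s] powi[of "1 + \<gamma>" k] by simp
  qed
qed

theorem theorem3:
  fixes N :: "('k::{real_normed_field,euclidean_space})^'n \<Rightarrow> real"
    and A :: "int \<Rightarrow> 'k^'n^'n"
    and t0 :: int
    and P P' :: "'k^'n^'n"
  assumes "is_norm N"
    and "\<And>t. invertible (A t)"
    and "exponential_dichotomy_with N A t0 P"
    and "exponential_dichotomy_with N A t0 P'"
  shows "P = P'"
proof -
  define X where "X = fundamental_matrix A t0"
  have inv: "matrix_inv (X t) ** X t = mat 1" for t
    unfolding X_def by (intro matrix_inv_mult_self invertible_fundamental_matrix assms(2))
  have X0: "X t0 = mat 1" "matrix_inv (X t0) = mat 1"
    using fundamental_matrix(1)[of A t0, OF assms(2)] inv[of t0] by (simp_all add: X_def)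
  \<comment> \<open>The identity \<open>matrix_inv (X s) ** X s = mat 1\<close> is inserted between
    \<open>U\<close> and \<open>V\<close>; the outer factors at \<open>t0\<close> are themselves the
    identity and only bring both factors into the shape of the dichotomy estimates.\<close>
  have split: "U ** V = (X t0 ** U ** matrix_inv (X s)) ** (X s ** V ** matrix_inv (X t0))" for U V s
  proof -
    have "(U ** matrix_inv (X s)) ** (X s ** V) = U ** (matrix_inv (X s) ** X s) ** V"
      by (simp only: matrix_mul_assoc)
    then show ?thesis by (simp add: inv X0(1) X0(2)[unfolded X0(1)])
  qed
  obtain \<alpha> \<beta> \<gamma> \<delta> where P: "\<alpha> > 0" "\<gamma> > 0"
    "\<And>t s k. t = s + int k \<Longrightarrow>
       op_norm N (X t ** P ** matrix_inv (X s)) \<le> \<beta> * inverse (1 + \<alpha>) ^ k"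
    "\<And>t s k. s = t + int k \<Longrightarrow>
       op_norm N (X t ** (mat 1 - P) ** matrix_inv (X s)) \<le> \<delta> * inverse (1 + \<gamma>) ^ k"
    unfolding X_def by (rule exponential_dichotomy_withE[OF assms(3)]) blast
  obtain \<alpha>' \<beta>' \<gamma>' \<delta>' where P': "\<alpha>' > 0" "\<gamma>' > 0"
    "\<And>t s k. t = s + int k \<Longrightarrow>
       op_norm N (X t ** P' ** matrix_inv (X s)) \<le> \<beta>' * inverse (1 + \<alpha>') ^ k"
    "\<And>t s k. s = t + int k \<Longrightarrow>
       op_norm N (X t ** (mat 1 - P') ** matrix_inv (X s)) \<le> \<delta>' * inverse (1 + \<gamma>') ^ k"
    unfolding X_def by (rule exponential_dichotomy_withE[OF assms(4)]) blast
  have "(mat 1 - P') ** P = 0"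
    by (rule eq_0_if_factors_decay[OF assms(1) split[where s = "t0 + int k" for k]
          P'(4) P(3) P'(2) P(1)]) simp_all
  \<comment> \<open>Here the left factor carries \<open>P'\<close> from time \<open>s\<close> to
    \<open>t0\<close>, an estimate valid for \<open>s\<close> at or before \<open>t0\<close>; hence
    the minus sign in \<open>s\<close>.\<close>
  moreover have "P' ** (mat 1 - P) = 0"
    by (rule eq_0_if_factors_decay[OF assms(1) split[where s = "t0 - int k" for k]
          P'(3) P(4) P'(1) P(2)]) simp_all
  \<comment> \<open>Expanded, the two vanishing products read \<open>P = P' ** P\<close> and
    \<open>P' = P' ** P\<close>.\<close>
  ultimately show ?thesis
    by (simp add: matrix_diff_ldistrib matrix_diff_rdistrib)
qed

end
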